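(* We have $W_{D_4^{(3)}}\cdot\varnothing=\mathcal C_6^g$.
   Context: A $6$-core is a partition having no hook length equal to $6$; $\mathcal C_6$ is the set of $6$-cores. The box in row $i$, column $j$ has residue $(j-i)\bmod 6$; boxes of residue $i$ are $i$-nodes. The affine Weyl group $\widetilde{\mathfrak S}_6$ of type $A_5^{(1)}$, with simple reflections $s_0,\dots,s_5$, acts on $\mathcal C_6$: $s_i\cdot c$ is obtained by removing all removable $i$-nodes of $c$ if there are some, adding all addable $i$-nodes if there are some, and $s_i\cdot c=c$ otherwise. A $6$-core $c$ is determined by the vector $\beta=(\beta_1,\dots,\beta_6)\in\mathbb Z^6$, $\beta_i=a_{i-1}(c)-a_{i\bmod 6}(c)$, where $a_i(c)$ is the number of $i$-nodes of $c$; every vector of $\mathbb Z^6$ with zero sum arises. $\mathcal C_6^g$ is the set of $6$-cores whose associated vector in $\mathbb Z^6$ is of the form $(\beta_1,\beta_2,\beta_1-\beta_2,\beta_2-\beta_1,-\beta_2,-\beta_1)$ with $\beta_1,\beta_2\in\mathbb Z$. The affine Weyl group $W_{D_4^{(3)}}$ of type $D_4^{(3)}$ is realized as the subgroup of $\widetilde{\mathfrak S}_6$ generated by $s_0s_1s_5s_0$, $s_2s_4$ and $s_1s_3s_5$. $\varnothing$ is the empty partition. *)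

theory Defs
  imports "HOL-Algebra.Group_Action" "HOL-Algebra.Generated_Groups"
begin

section \<open>Partitions, hook lengths and 6-cores\<close>

text \<open>A partition is represented by its Young diagram. Boxes are indexed from 0, which changes
  neither residues nor hook lengths.\<close>

definition is_partition :: "(nat \<times> nat) set \<Rightarrow> bool" where
  "is_partition c \<longleftrightarrow> finite c \<and>
     (\<forall>r k r' k'. (r, k) \<in> c \<longrightarrow> r' \<le> r \<longrightarrow> k' \<le> k \<longrightarrow> (r', k') \<in> c)"

definition hook_length :: "(nat \<times> nat) set \<Rightarrow> nat \<Rightarrow> nat \<Rightarrow> nat" where
  "hook_length c r k =
     card {(r', k') \<in> c. r' = r \<and> k < k'} + card {(r', k') \<in> c. k' = k \<and> r < r'} + 1"

definition cores6 :: "(nat \<times> nat) set set" where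
  "cores6 = {c. is_partition c \<and> (\<forall>(r, k) \<in> c. hook_length c r k \<noteq> 6)}"

definition residue :: "nat \<times> nat \<Rightarrow> nat" where
  "residue b = nat ((int (snd b) - int (fst b)) mod 6)"

definition removable :: "nat \<Rightarrow> (nat \<times> nat) set \<Rightarrow> (nat \<times> nat) set" where
  "removable i c = {b. residue b = i \<and> b \<in> c \<and> is_partition (c - {b})}"

definition addable :: "nat \<Rightarrow> (nat \<times> nat) set \<Rightarrow> (nat \<times> nat) set" where
  "addable i c = {b. residue b = i \<and> b \<notin> c \<and> is_partition (insert b c)}"

definition refl_act :: "nat \<Rightarrow> (nat \<times> nat) set \<Rightarrow> (nat \<times> nat) set" where
  "refl_act i c =
     (if removable i c \<noteq> {} then c - removable i c
      else if addable i c \<noteq> {} then c \<union> addable i c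
      else c)"

definition num_nodes :: "nat \<Rightarrow> (nat \<times> nat) set \<Rightarrow> nat" where
  "num_nodes i c = card {b \<in> c. residue b = i}"

definition beta :: "(nat \<times> nat) set \<Rightarrow> int list" where
  "beta c = map (\<lambda>i. int (num_nodes (i - 1) c) - int (num_nodes (i mod 6) c)) [1..<7]"

definition cores6_g :: "(nat \<times> nat) set set" where
  "cores6_g = {c \<in> cores6. \<exists>b1 b2 :: int. beta c = [b1, b2, b1 - b2, b2 - b1, - b2, - b1]}"


section \<open>The affine Weyl group of type \<open>A\<^sub>5\<^sup>(\<^sup>1\<^sup>)\<close>\<close>

text \<open>The group is the Coxeter group with generators \<open>s\<^sub>0, \<dots>, s\<^sub>5\<close>, realized as the quotient of the
  monoid of words in \<open>{0, \<dots>, 5}\<close> by the congruence generated by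
  \<open>(s\<^sub>i s\<^sub>j)\<^sup>m \<sim> 1\<close> with \<open>m = cox_m i j\<close>; the Dynkin diagram is a 6-cycle.\<close>

definition cox_m :: "nat \<Rightarrow> nat \<Rightarrow> nat" where
  "cox_m i j = (if i = j then 1 else if j = (i + 1) mod 6 \<or> i = (j + 1) mod 6 then 3 else 2)"

inductive cox_step :: "nat list \<Rightarrow> nat list \<Rightarrow> bool" where
  "i < 6 \<Longrightarrow> j < 6 \<Longrightarrow>
     cox_step (u @ concat (replicate (cox_m i j) [i, j]) @ v) (u @ v)"

definition words :: "nat list set" where
  "words = lists {..<6}"

definition cox_rel :: "(nat list \<times> nat list) set" where
  "cox_rel = {(u, v). u \<in> words \<and> v \<in> words \<and> equivclp cox_step u v}"

definition aff_S6 :: "nat list set monoid" where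
  "aff_S6 = \<lparr>carrier = words // cox_rel,
             mult = (\<lambda>X Y. \<Union>u\<in>X. \<Union>v\<in>Y. cox_rel `` {u @ v}),
             one = cox_rel `` {[]}\<rparr>"

definition word_elt :: "nat list \<Rightarrow> nat list set" where
  "word_elt u = cox_rel `` {u}"

definition word_act :: "nat list \<Rightarrow> (nat \<times> nat) set \<Rightarrow> (nat \<times> nat) set" where
  "word_act u c = foldr refl_act u c"

text \<open>An element of the group acts on 6-cores through any word that represents it. That the result
  does not depend on the word is the well-definedness of the action; it is not built into the
  definition, which otherwise leaves the value unspecified.\<close>

definition core_act :: "nat list set \<Rightarrow> (nat \<times> nat) set \<Rightarrow> (nat \<times> nat) set" where
  "core_act w = (\<lambda>c\<in>cores6. the_elem ((\<lambda>u. word_act u c) ` w))"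

definition W_D43 :: "nat list set set" where
  "W_D43 = generate aff_S6 {word_elt [0, 1, 5, 0], word_elt [2, 4], word_elt [1, 3, 5]}"


section \<open>The quotient is a group\<close>

lemma cox_step_context: "cox_step u v \<Longrightarrow> cox_step (x @ u @ y) (x @ v @ y)"
proof (induction rule: cox_step.induct)
  case (1 i j u v)
  then show ?case
    using cox_step.intros[of i j "x @ u" "v @ y"] by simp
qed

lemma equivclp_context:
  "equivclp cox_step u v \<Longrightarrow> equivclp cox_step (x @ u @ y) (x @ v @ y)"
proof (induction rule: equivclp_induct)
  case base
  show ?case by simp
next
  case (step v w)
  have "equivclp cox_step (x @ v @ y) (x @ w @ y)"
    using step(2) cox_step_context by (blast intro: r_into_equivclp converse_r_into_equivclp)
  then show ?case using step(3) by (blast intro: equivclp_trans)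
qed

lemma equiv_cox_rel: "equiv words cox_rel"
proof (rule equivI)
  show "refl_on words cox_rel" by (auto simp: cox_rel_def refl_on_def)
  show "sym cox_rel" by (auto simp: cox_rel_def sym_def dest: equivclp_sym)
  show "trans cox_rel" by (auto simp: cox_rel_def trans_def dest: equivclp_trans)
qed (auto simp: cox_rel_def)

lemma cox_rel_append:
  assumes "(u, u') \<in> cox_rel" "(v, v') \<in> cox_rel"
  shows "(u @ v, u' @ v') \<in> cox_rel"
proof -
  have "equivclp cox_step (u @ v) (u' @ v)" "equivclp cox_step (u' @ v) (u' @ v')"
    using assms equivclp_context[of u u' "[]" v] equivclp_context[of v v' u' "[]"]
    by (auto simp: cox_rel_def)
  then show ?thesis
    using assms equivclp_trans[of cox_step "u @ v" "u' @ v" "u' @ v'"]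
    by (simp add: cox_rel_def words_def)
qed

lemma mult_word_elt:
  assumes "u \<in> words" "v \<in> words"
  shows "word_elt u \<otimes>\<^bsub>aff_S6\<^esub> word_elt v = word_elt (u @ v)"
proof -
  have *: "u \<in> cox_rel `` {u}" "v \<in> cox_rel `` {v}"
    using assms by (simp_all add: cox_rel_def)
  have "cox_rel `` {u' @ v'} = cox_rel `` {u @ v}"
    if "u' \<in> cox_rel `` {u}" "v' \<in> cox_rel `` {v}" for u' v'
    using equiv_class_eq[OF equiv_cox_rel cox_rel_append[of u u' v v']] that by simp
  then have "(\<Union>u'\<in>cox_rel `` {u}. \<Union>v'\<in>cox_rel `` {v}. cox_rel `` {u' @ v'}) =
      (\<Union>u'\<in>cox_rel `` {u}. \<Union>v'\<in>cox_rel `` {v}. cox_rel `` {u @ v})"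
    by (intro SUP_cong refl) blast
  also have "\<dots> = cox_rel `` {u @ v}"
    using * by blast
  finally show ?thesis
    by (simp add: word_elt_def aff_S6_def)
qed

lemma append_in_words: "u \<in> words \<Longrightarrow> v \<in> words \<Longrightarrow> u @ v \<in> words"
  by (simp add: words_def)

lemma carrier_aff_S6: "carrier aff_S6 = word_elt ` words"
  by (auto simp: aff_S6_def quotient_def word_elt_def)

lemma one_aff_S6: "\<one>\<^bsub>aff_S6\<^esub> = word_elt []"
  by (simp add: aff_S6_def word_elt_def)

lemma word_elt_rev:
  assumes "u \<in> words" shows "word_elt (rev u @ u) = word_elt []"
  using assms
proof (induction u)
  case (Cons i u)
  then have w: "i < 6" "u \<in> words" by (auto simp: words_def)
  have "cox_step (rev u @ concat (replicate (cox_m i i) [i, i]) @ u) (rev u @ u)"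
    using cox_step.intros w by blast
  then have "(rev (i # u) @ i # u, rev u @ u) \<in> cox_rel"
    using w by (auto simp: cox_rel_def words_def cox_m_def)
  then show ?case
    using Cons.IH[OF w(2)] equiv_class_eq[OF equiv_cox_rel] by (simp add: word_elt_def)
qed simp

lemma group_aff_S6: "group aff_S6"
proof (rule groupI)
  fix X assume "X \<in> carrier aff_S6"
  then obtain u where u: "u \<in> words" "X = word_elt u" by (auto simp: carrier_aff_S6)
  then have "rev u \<in> words" by (auto simp: words_def)
  then show "\<exists>Y\<in>carrier aff_S6. Y \<otimes>\<^bsub>aff_S6\<^esub> X = \<one>\<^bsub>aff_S6\<^esub>"
    using u by (auto simp: carrier_aff_S6 mult_word_elt one_aff_S6 word_elt_rev
        intro!: bexI[of _ "rev u"])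
next
  have nil: "[] \<in> words" by (simp add: words_def)
  show "\<one>\<^bsub>aff_S6\<^esub> \<in> carrier aff_S6"
    using nil by (simp add: carrier_aff_S6 one_aff_S6)
  fix X assume "X \<in> carrier aff_S6"
  then show "\<one>\<^bsub>aff_S6\<^esub> \<otimes>\<^bsub>aff_S6\<^esub> X = X"
    using nil by (auto simp: carrier_aff_S6 one_aff_S6 mult_word_elt)
qed (auto simp: carrier_aff_S6 mult_word_elt append_in_words)

end

theory Submission
  imports Defs
begin

text \<open>A partition with row lengths \<open>\<lambda>\<^sub>0 \<ge> \<lambda>\<^sub>1 \<ge> \<dots>\<close> is encoded by its set of beads
  \<open>\<lambda>\<^sub>r - r\<close>, \<open>r = 0, 1, \<dots>\<close>. The hook lengths in row \<open>r\<close> are exactly the distances from the bead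
  \<open>\<lambda>\<^sub>r - r\<close> down to the integers below it that carry no bead. So a partition is a 6-core iff its bead
  set is closed under subtracting 6 (\<open>cores6_iff_beads\<close>): on each of the six runners, that is,
  residue classes modulo 6, the beads fill everything up to some level and nothing above it. The
  residues along one row of boxes telescope, and therefore \<open>beta\<close> records precisely these levels
  (\<open>beads_eq_maya_beta\<close>). In particular \<open>beta\<close> is injective on 6-cores.

  Removing or adding a node of residue \<open>i\<close> moves a bead one step between the runners \<open>i\<close> and \<open>i + 1\<close>.
  A 6-core cannot have both removable and addable \<open>i\<close>-nodes, because the higher of the two adjacent
  runners blocks all moves in the other direction; so \<open>s\<^sub>i\<close> exchanges the two runners
  (\<open>mem_beads_refl_act_iff\<close>). On \<open>beta\<close> this swaps two adjacent entries, with a shift by one when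
  \<open>i = 0\<close> (\<open>beta_refl_act\<close>). The Coxeter relations can be read off from vectors with six entries,
  and by injectivity of \<open>beta\<close> they hold on 6-cores, so that the value of \<open>core_act\<close> on a class of
  words is the value of any word in it (\<open>core_act_word_elt\<close>).

  It remains to study the vectors \<open>(a, b, a - b, b - a, - b, - a)\<close>. On their parameters the three
  generators of the subgroup act by \<open>(a, b) \<mapsto> (1 - b, 1 - a)\<close>, \<open>(a, b) \<mapsto> (a, a - b)\<close> and
  \<open>(a, b) \<mapsto> (b, a)\<close>. Hence the orbit of the empty partition, whose parameters are \<open>(0, 0)\<close>, stays in
  this family. The last two maps generate the finite Weyl group of type \<open>G\<^sub>2\<close>; it contains
  \<open>(a, b) \<mapsto> (- b, - a)\<close>, which composed with the first map is the translation by \<open>(1, 1)\<close>. The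
  conjugates of this translation generate all translations of \<open>\<int>\<^sup>2\<close>, so every pair of parameters is
  reached (\<open>lattice_transitive\<close>), and injectivity of \<open>beta\<close> turns this into a statement about
  6-cores.\<close>


section \<open>Row lengths, column lengths and beads\<close>

definition row_len :: "(nat \<times> nat) set \<Rightarrow> nat \<Rightarrow> nat" where
  "row_len c r = card {k. (r, k) \<in> c}"

definition col_len :: "(nat \<times> nat) set \<Rightarrow> nat \<Rightarrow> nat" where
  "col_len c k = card {r. (r, k) \<in> c}"

text \<open>These are the first-column hook lengths of the partition, shifted so that no choice of the
  number of rows is involved: the rows of length 0 contribute all sufficiently small integers.\<close>

definition bead :: "(nat \<times> nat) set \<Rightarrow> nat \<Rightarrow> int" where
  "bead c r = int (row_len c r) - int r"

abbreviation beads :: "(nat \<times> nat) set \<Rightarrow> int set" where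
  "beads c \<equiv> range (bead c)"

lemma finite_down_set_eq_lessThan_card:
  fixes S :: "nat set"
  assumes "finite S" "\<And>a b. a \<in> S \<Longrightarrow> b \<le> a \<Longrightarrow> b \<in> S"
  shows "S = {..<card S}"
proof -
  obtain n where n: "n \<notin> S" using assms(1) ex_new_if_finite infinite_UNIV_nat by blast
  define m where "m = (LEAST n. n \<notin> S)"
  have m: "m \<notin> S" unfolding m_def using n by (rule LeastI)
  have "\<And>a. a < m \<Longrightarrow> a \<in> S" unfolding m_def using not_less_Least by blast
  then have "S = {..<m}" using m assms(2) by (auto simp: not_less) (meson not_le)
  then show ?thesis by simp
qed

lemma partition_down:
  "is_partition c \<Longrightarrow> (r, k) \<in> c \<Longrightarrow> r' \<le> r \<Longrightarrow> k' \<le> k \<Longrightarrow> (r', k') \<in> c"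
  by (auto simp: is_partition_def)

lemma finite_row: "is_partition c \<Longrightarrow> finite {k. (r, k) \<in> c}"
  by (rule finite_surj[of c _ snd]) (force simp: is_partition_def)+

lemma finite_col: "is_partition c \<Longrightarrow> finite {r. (r, k) \<in> c}"
  by (rule finite_surj[of c _ fst]) (force simp: is_partition_def)+

lemma mem_iff_row_len:
  assumes "is_partition c" shows "(r, k) \<in> c \<longleftrightarrow> k < row_len c r"
proof -
  have "{k. (r, k) \<in> c} = {..<row_len c r}" unfolding row_len_def
    by (rule finite_down_set_eq_lessThan_card) (auto intro: finite_row assms partition_down[OF assms])
  then show ?thesis by auto
qed

lemma mem_iff_col_len:
  assumes "is_partition c" shows "(r, k) \<in> c \<longleftrightarrow> r < col_len c k"
proof -
  have "{r. (r, k) \<in> c} = {..<col_len c k}" unfolding col_len_def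
    by (rule finite_down_set_eq_lessThan_card) (auto intro: finite_col assms partition_down[OF assms])
  then show ?thesis by auto
qed

lemma row_len_eqI: "{k. (r, k) \<in> c} = {..<n} \<Longrightarrow> row_len c r = n"
  by (simp add: row_len_def)

lemma row_len_antimono:
  assumes "is_partition c" "r \<le> s" shows "row_len c s \<le> row_len c r"
  by (rule ccontr) (use assms partition_down[OF assms(1), of s "row_len c r" r "row_len c r"]
      in \<open>auto simp: mem_iff_row_len\<close>)

lemma eventually_row_len_0:
  assumes "is_partition c" obtains N where "\<And>r. r \<ge> N \<Longrightarrow> row_len c r = 0"
proof
  fix r assume "r \<ge> col_len c 0"
  then show "row_len c r = 0"
    using mem_iff_col_len[OF assms, of r 0] mem_iff_row_len[OF assms, of r 0] by simp
qed

lemma bead_strict_antimono: "is_partition c \<Longrightarrow> r < s \<Longrightarrow> bead c s < bead c r"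
  using row_len_antimono[of c r s] by (simp add: bead_def)

lemma bead_less_iff: "is_partition c \<Longrightarrow> bead c s < bead c r \<longleftrightarrow> r < s"
  by (metis bead_strict_antimono less_asym linorder_neqE_nat less_irrefl)

lemma inj_bead: "is_partition c \<Longrightarrow> inj (bead c)"
  by (metis bead_less_iff injI less_irrefl linorder_neqE_nat)

text \<open>The \<open>r\<close>-th bead is recovered from the set, since the beads decrease strictly: it exceeds \<open>y\<close> iff
  the set has more than \<open>r\<close> elements above \<open>y\<close>.\<close>

lemma partition_eq_if_beads_eq:
  assumes c: "is_partition c" and d: "is_partition d" and eq: "beads c = beads d"
  shows "c = d"
proof -
  have *: "(r, k) \<in> e \<longleftrightarrow> r < card {x \<in> beads e. x > int k - int r}"
    if e: "is_partition e" for e r k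
  proof -
    obtain N where N: "\<And>s. s \<ge> N \<Longrightarrow> row_len e s = 0" using eventually_row_len_0[OF e] by blast
    let ?S = "{s. bead e s > int k - int r}"
    have "?S \<subseteq> {..<N + r}"
    proof
      fix s assume "s \<in> ?S"
      then show "s \<in> {..<N + r}" using N[of s] by (cases "s \<ge> N") (auto simp: bead_def)
    qed
    then have "finite ?S" by (rule finite_subset) simp
    moreover have "b \<in> ?S" if "a \<in> ?S" "b \<le> a" for a b
      using that bead_strict_antimono[OF e, of b a] by (cases "b = a") auto
    ultimately have "?S = {..<card ?S}" by (rule finite_down_set_eq_lessThan_card)
    moreover have "card ?S = card (bead e ` ?S)"
      by (metis card_image inj_bead[OF e] inj_on_subset subset_UNIV)
    moreover have "bead e ` ?S = {x \<in> beads e. x > int k - int r}" by auto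
    moreover have "(r, k) \<in> e \<longleftrightarrow> r \<in> ?S" by (auto simp: mem_iff_row_len[OF e] bead_def)
    ultimately show ?thesis by (metis lessThan_iff)
  qed
  have "p \<in> c \<longleftrightarrow> p \<in> d" for p using *[OF c] *[OF d] eq by (cases p) simp
  then show ?thesis by blast
qed


section \<open>Hooks and gaps\<close>

text \<open>The number subtracted depends only on the column. The next two lemmas show that, as the column
  varies, it runs exactly through the integers that are not beads.\<close>

lemma hook_length_eq_bead_minus_gap:
  assumes c: "is_partition c" and b: "(r, k) \<in> c"
  shows "int (hook_length c r k) = bead c r - (int k + 1 - int (col_len c k))"
proof -
  have "{(r', k') \<in> c. r' = r \<and> k < k'} = Pair r ` {k<..<row_len c r}"
    by (auto simp: mem_iff_row_len[OF c])
  then have 1: "card {(r', k') \<in> c. r' = r \<and> k < k'} = row_len c r - Suc k"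
    by (simp add: card_image inj_on_def)
  have "{(r', k') \<in> c. k' = k \<and> r < r'} = (\<lambda>r'. (r', k)) ` {r<..<col_len c k}"
    by (auto simp: mem_iff_col_len[OF c])
  then have 2: "card {(r', k') \<in> c. k' = k \<and> r < r'} = col_len c k - Suc r"
    by (simp add: card_image inj_on_def)
  have "k < row_len c r" "r < col_len c k"
    using b mem_iff_row_len[OF c] mem_iff_col_len[OF c] by auto
  then show ?thesis unfolding hook_length_def 1 2 bead_def by linarith
qed

text \<open>If row \<open>s\<close> had this number as its bead, then \<open>k < \<lambda>\<^sub>s\<close> would be equivalent to
  \<open>s \<ge> col_len c k\<close>, whereas both \<open>k < \<lambda>\<^sub>s\<close> and \<open>s < col_len c k\<close> say that the box \<open>(s, k)\<close> is in \<open>c\<close>.\<close>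

lemma gap_notin_beads:
  assumes c: "is_partition c" shows "int k + 1 - int (col_len c k) \<notin> beads c"
proof
  assume "int k + 1 - int (col_len c k) \<in> beads c"
  then obtain s where "int k + 1 - int (col_len c k) = bead c s" by auto
  moreover have "k < row_len c s \<longleftrightarrow> s < col_len c k"
    using mem_iff_row_len[OF c] mem_iff_col_len[OF c] by auto
  ultimately show False by (auto simp: bead_def)
qed

text \<open>The column is found on the boundary of the diagram: if exactly \<open>n\<close> beads lie above the gap \<open>g\<close>,
  it is the column \<open>g + n - 1\<close>, and it has length \<open>n\<close>.\<close>

lemma gap_if_notin_beads:
  assumes c: "is_partition c" and g: "g \<notin> beads c"
  obtains k where "g = int k + 1 - int (col_len c k)"
proof -
  obtain N where N: "\<And>s. s \<ge> N \<Longrightarrow> row_len c s = 0" using eventually_row_len_0[OF c] by blast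
  define n where "n = (LEAST n. bead c n < g)"
  have "bead c (N + nat (1 - g)) < g" using N by (simp add: bead_def)
  then have n: "bead c n < g" unfolding n_def by (rule LeastI)
  have n': "bead c m > g" if "m < n" for m
    using not_less_Least[OF that[unfolded n_def]] g by (metis linorder_neqE_linordered_idom rangeI)
  define k where "k = nat (g + int n - 1)"
  have k: "int k = g + int n - 1" "row_len c n \<le> k"
    using n by (auto simp: k_def bead_def)
  have "col_len c k \<le> n" using k(2) mem_iff_row_len[OF c, of n k] mem_iff_col_len[OF c, of n k] by simp
  moreover have "n \<le> col_len c k"
  proof (cases n)
    case (Suc m)
    then have "k < row_len c m" using n'[of m] k(1) by (simp add: bead_def)
    then show ?thesis using mem_iff_row_len[OF c, of m k] mem_iff_col_len[OF c, of m k] Suc by simp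
  qed simp
  ultimately have "g = int k + 1 - int (col_len c k)" using k(1) by simp
  then show ?thesis by (rule that)
qed

lemma cores6_iff_beads:
  assumes c: "is_partition c"
  shows "c \<in> cores6 \<longleftrightarrow> (\<forall>x\<in>beads c. x - 6 \<in> beads c)"
proof
  assume core: "c \<in> cores6"
  show "\<forall>x\<in>beads c. x - 6 \<in> beads c"
  proof (rule ballI, rule ccontr)
    fix x assume "x \<in> beads c" and g: "x - 6 \<notin> beads c"
    then obtain r where x: "x = bead c r" by auto
    obtain k where k: "x - 6 = int k + 1 - int (col_len c k)"
      by (rule gap_if_notin_beads[OF c g])
    have "k < row_len c r \<longleftrightarrow> r < col_len c k"
      using mem_iff_row_len[OF c] mem_iff_col_len[OF c] by auto
    then have "k < row_len c r" using k x by (auto simp: bead_def)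
    then have b: "(r, k) \<in> c" by (simp add: mem_iff_row_len[OF c])
    then have "hook_length c r k = 6" using hook_length_eq_bead_minus_gap[OF c b] k x by simp
    then show False using core b by (auto simp: cores6_def)
  qed
next
  assume closed: "\<forall>x\<in>beads c. x - 6 \<in> beads c"
  have "hook_length c r k \<noteq> 6" if b: "(r, k) \<in> c" for r k
  proof
    assume "hook_length c r k = 6"
    then have "int k + 1 - int (col_len c k) = bead c r - 6"
      using hook_length_eq_bead_minus_gap[OF c b] by simp
    then show False using gap_notin_beads[OF c, of k] closed by (metis rangeI)
  qed
  then show "c \<in> cores6" using c by (auto simp: cores6_def)
qed

lemma cores6_partition: "c \<in> cores6 \<Longrightarrow> is_partition c"
  by (simp add: cores6_def)

text \<open>On each runner the beads of a 6-core are flush, with no empty position below a bead.\<close>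

lemma core_beads_down:
  assumes "c \<in> cores6" "x \<in> beads c" "y \<le> x" "x mod 6 = y mod 6" shows "y \<in> beads c"
proof -
  have *: "x - 6 * int n \<in> beads c" for n
  proof (induction n)
    case (Suc n)
    have "x - 6 * int n - 6 \<in> beads c"
      using Suc cores6_iff_beads[OF cores6_partition[OF assms(1)]] assms(1) by blast
    then show ?case by (simp add: algebra_simps)
  qed (use assms in auto)
  have "6 dvd x - y" using assms(4) by (simp add: mod_eq_dvd_iff)
  then obtain q where "x - y = 6 * q" by (auto simp: dvd_def)
  then have "y = x - 6 * int (nat q)" using assms(3) by auto
  then show ?thesis using * by metis
qed


section \<open>Reflections move beads between adjacent runners\<close>

lemma removable_iff:
  assumes c: "is_partition c"
  shows "(r, k) \<in> removable i c \<longleftrightarrow>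
    residue (r, k) = i \<and> (r, k) \<in> c \<and> (r, Suc k) \<notin> c \<and> (Suc r, k) \<notin> c"
proof -
  have "is_partition (c - {(r, k)}) \<longleftrightarrow> (r, Suc k) \<notin> c \<and> (Suc r, k) \<notin> c"
  proof (intro iffI conjI)
    assume p: "is_partition (c - {(r, k)})"
    show "(r, Suc k) \<notin> c" using partition_down[OF p, of r "Suc k" r k] by auto
    show "(Suc r, k) \<notin> c" using partition_down[OF p, of "Suc r" k r k] by auto
  next
    assume n: "(r, Suc k) \<notin> c \<and> (Suc r, k) \<notin> c"
    have "(r', k') \<in> c \<and> (r', k') \<noteq> (r, k)"
      if "(a, b) \<in> c" "(a, b) \<noteq> (r, k)" "r' \<le> a" "k' \<le> b" for a b r' k'
    proof -
      have "\<not> (r \<le> a \<and> Suc k \<le> b)" "\<not> (Suc r \<le> a \<and> k \<le> b)"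
        using n partition_down[OF c that(1)] by blast+
      then show ?thesis using partition_down[OF c that(1,3,4)] that by auto
    qed
    then show "is_partition (c - {(r, k)})" using c unfolding is_partition_def by auto
  qed
  then show ?thesis by (auto simp: removable_def)
qed

lemma addable_iff:
  assumes c: "is_partition c"
  shows "(r, k) \<in> addable i c \<longleftrightarrow>
    residue (r, k) = i \<and> (r, k) \<notin> c \<and> (r = 0 \<or> (r - 1, k) \<in> c) \<and> (k = 0 \<or> (r, k - 1) \<in> c)"
proof -
  have "is_partition (insert (r, k) c) \<longleftrightarrow> (r = 0 \<or> (r - 1, k) \<in> c) \<and> (k = 0 \<or> (r, k - 1) \<in> c)"
    if "(r, k) \<notin> c"
  proof (intro iffI conjI)
    assume p: "is_partition (insert (r, k) c)"
    show "r = 0 \<or> (r - 1, k) \<in> c" using partition_down[OF p, of r k "r - 1" k] by auto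
    show "k = 0 \<or> (r, k - 1) \<in> c" using partition_down[OF p, of r k r "k - 1"] by auto
  next
    assume n: "(r = 0 \<or> (r - 1, k) \<in> c) \<and> (k = 0 \<or> (r, k - 1) \<in> c)"
    have "(r', k') \<in> insert (r, k) c" if b: "(a, b) \<in> insert (r, k) c" "r' \<le> a" "k' \<le> b" for a b r' k'
    proof (cases "(a, b) \<in> c")
      case True
      then show ?thesis using partition_down[OF c True b(2,3)] by auto
    next
      case False
      then have ab: "a = r" "b = k" using b by auto
      consider "r' = r" "k' = k" | "r' \<le> r - 1" "0 < r" | "k' \<le> k - 1" "0 < k"
        using b(2,3) ab by linarith
      then show ?thesis
        using n b(2,3) ab partition_down[OF c, of "r - 1" k r' k']
          partition_down[OF c, of r "k - 1" r' k'] by cases auto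
    qed
    then show "is_partition (insert (r, k) c)" using c unfolding is_partition_def by auto
  qed
  then show ?thesis by (auto simp: addable_def)
qed

text \<open>The position just below a bead can only be taken by the bead of the next row, because beads of
  different rows are distinct and decreasing. So the position is free iff the last box of the row can
  be removed.\<close>

lemma bead_pred_in_beads_iff:
  assumes c: "is_partition c"
  shows "bead c r - 1 \<in> beads c \<longleftrightarrow> row_len c (Suc r) = row_len c r"
proof
  assume "bead c r - 1 \<in> beads c"
  then obtain s where s: "bead c s = bead c r - 1" by auto
  then have "r < s" using bead_less_iff[OF c, of s r] by simp
  moreover have "\<not> Suc r < s"
    using bead_strict_antimono[OF c, of "Suc r" s] bead_strict_antimono[OF c, of r "Suc r"] s by auto
  ultimately have "s = Suc r" by simp
  then show "row_len c (Suc r) = row_len c r" using s by (simp add: bead_def)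
next
  assume "row_len c (Suc r) = row_len c r"
  then have "bead c r - 1 = bead c (Suc r)" by (simp add: bead_def)
  then show "bead c r - 1 \<in> beads c" by simp
qed

lemma bead_succ_in_beads_iff:
  assumes c: "is_partition c"
  shows "bead c r + 1 \<in> beads c \<longleftrightarrow> r > 0 \<and> row_len c (r - 1) = row_len c r"
proof
  assume "bead c r + 1 \<in> beads c"
  then obtain s where s: "bead c s = bead c r + 1" by auto
  then have "bead c s - 1 \<in> beads c" by simp
  then have *: "row_len c (Suc s) = row_len c s" by (simp add: bead_pred_in_beads_iff[OF c])
  then have "bead c (Suc s) = bead c r" using s by (simp add: bead_def)
  then have "r = Suc s" using inj_bead[OF c] by (auto dest: injD)
  then show "r > 0 \<and> row_len c (r - 1) = row_len c r" using * by simp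
next
  assume "r > 0 \<and> row_len c (r - 1) = row_len c r"
  then have "bead c r + 1 = bead c (r - 1)" by (auto simp: bead_def of_nat_diff)
  then show "bead c r + 1 \<in> beads c" by simp
qed

lemma residue_eq_iff: "residue (r, k) = i \<longleftrightarrow> (int k - int r) mod 6 = int i"
  by (auto simp: residue_def)

text \<open>A removable node of content \<open>d\<close> is a bead at \<open>d + 1\<close> with nothing at \<open>d\<close>, and an addable node of
  content \<open>d\<close> is a bead at \<open>d\<close> with nothing at \<open>d + 1\<close>.\<close>

lemma removable_iff_bead:
  assumes c: "is_partition c"
  shows "(r, k) \<in> removable i c \<longleftrightarrow>
    int k = bead c r + int r - 1 \<and> (bead c r - 1) mod 6 = int i \<and> bead c r - 1 \<notin> beads c"
proof -
  have "row_len c (Suc r) \<le> row_len c r" using row_len_antimono[OF c] by simp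
  then have "(r, k) \<in> c \<and> (r, Suc k) \<notin> c \<and> (Suc r, k) \<notin> c \<longleftrightarrow>
      int k = bead c r + int r - 1 \<and> row_len c (Suc r) \<noteq> row_len c r"
    unfolding mem_iff_row_len[OF c] bead_def by linarith
  moreover have "int k - int r = bead c r - 1" if "int k = bead c r + int r - 1"
    using that by simp
  ultimately show ?thesis
    unfolding removable_iff[OF c] bead_pred_in_beads_iff[OF c] residue_eq_iff by metis
qed

lemma addable_iff_bead:
  assumes c: "is_partition c"
  shows "(r, k) \<in> addable i c \<longleftrightarrow>
    int k = bead c r + int r \<and> bead c r mod 6 = int i \<and> bead c r + 1 \<notin> beads c"
proof -
  have "row_len c r \<le> row_len c (r - 1)" using row_len_antimono[OF c] by simp
  then have "(r, k) \<notin> c \<and> (r = 0 \<or> (r - 1, k) \<in> c) \<and> (k = 0 \<or> (r, k - 1) \<in> c) \<longleftrightarrow>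
      int k = bead c r + int r \<and> \<not> (r > 0 \<and> row_len c (r - 1) = row_len c r)"
    unfolding mem_iff_row_len[OF c] bead_def by linarith
  moreover have "int k - int r = bead c r" if "int k = bead c r + int r"
    using that by simp
  ultimately show ?thesis
    unfolding addable_iff[OF c] bead_succ_in_beads_iff[OF c] residue_eq_iff by metis
qed

text \<open>Nodes of one residue can be removed, or added, all at once: two different removable boxes are
  incomparable, so that none of them is needed to support another one, and an addable box is
  supported by boxes of \<open>c\<close> alone.\<close>

lemma partition_remove:
  assumes c: "is_partition c" shows "is_partition (c - removable i c)"
proof -
  have "(r', k') \<in> c - removable i c"
    if "(r, k) \<in> c - removable i c" "r' \<le> r" "k' \<le> k" for r k r' k'
  proof -
    have "(r', k') \<notin> removable i c"
    proof
      assume "(r', k') \<in> removable i c"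
      then have "(r', Suc k') \<notin> c" "(Suc r', k') \<notin> c" by (simp_all add: removable_iff[OF c])
      then have "\<not> (r' \<le> r \<and> Suc k' \<le> k)" "\<not> (Suc r' \<le> r \<and> k' \<le> k)"
        using that(1) partition_down[OF c] by blast+
      then have "(r', k') = (r, k)" using that by auto
      then show False using that(1) \<open>(r', k') \<in> removable i c\<close> by simp
    qed
    then show ?thesis using that partition_down[OF c] by blast
  qed
  then show ?thesis using c unfolding is_partition_def by blast
qed

lemma partition_add:
  assumes c: "is_partition c" shows "is_partition (c \<union> addable i c)"
proof -
  have "addable i c \<subseteq> {(0, 0)} \<union> (\<lambda>(r, k). (Suc r, k)) ` c \<union> (\<lambda>(r, k). (r, Suc k)) ` c"
  proof
    fix b assume b: "b \<in> addable i c"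
    obtain r k where rk: "b = (r, k)" by force
    show "b \<in> {(0, 0)} \<union> (\<lambda>(r, k). (Suc r, k)) ` c \<union> (\<lambda>(r, k). (r, Suc k)) ` c"
      using b unfolding rk addable_iff[OF c] by (cases r; cases k) (auto simp: image_iff split: prod.splits)
  qed
  moreover have "finite c" using c by (simp add: is_partition_def)
  ultimately have "finite (c \<union> addable i c)" by (auto intro: finite_subset)
  moreover have "(r', k') \<in> c \<union> addable i c"
    if b: "(r, k) \<in> c \<union> addable i c" "r' \<le> r" "k' \<le> k" for r k r' k'
  proof (cases "(r, k) \<in> c")
    case True
    then show ?thesis using partition_down[OF c True b(2,3)] by simp
  next
    case False
    then have *: "(r, k) \<in> addable i c" using b by simp
    consider "r' = r" "k' = k" | "r' \<le> r - 1" "0 < r" | "k' \<le> k - 1" "0 < k"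
      using b(2,3) by linarith
    then show ?thesis
      using * b partition_down[OF c, of "r - 1" k r' k'] partition_down[OF c, of r "k - 1" r' k']
      unfolding addable_iff[OF c] by cases auto
  qed
  ultimately show ?thesis unfolding is_partition_def by blast
qed

lemma bead_remove:
  assumes c: "is_partition c"
  shows "bead (c - removable i c) r =
    (if (bead c r - 1) mod 6 = int i \<and> bead c r - 1 \<notin> beads c then bead c r - 1 else bead c r)"
proof (cases "(bead c r - 1) mod 6 = int i \<and> bead c r - 1 \<notin> beads c")
  case True
  then have "row_len c (Suc r) < row_len c r"
    using row_len_antimono[OF c, of r "Suc r"] by (auto simp: bead_pred_in_beads_iff[OF c])
  moreover have "row_len (c - removable i c) r = row_len c r - 1"
    by (rule row_len_eqI)
      (use True in \<open>auto simp: removable_iff_bead[OF c] mem_iff_row_len[OF c] bead_def\<close>)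
  ultimately show ?thesis using True by (simp add: bead_def)
next
  case False
  then have "row_len (c - removable i c) r = row_len c r"
    by (intro row_len_eqI) (auto simp: removable_iff_bead[OF c] mem_iff_row_len[OF c])
  then show ?thesis unfolding if_not_P[OF False] by (simp add: bead_def)
qed

lemma bead_add:
  assumes c: "is_partition c"
  shows "bead (c \<union> addable i c) r =
    (if bead c r mod 6 = int i \<and> bead c r + 1 \<notin> beads c then bead c r + 1 else bead c r)"
proof (cases "bead c r mod 6 = int i \<and> bead c r + 1 \<notin> beads c")
  case True
  have "row_len (c \<union> addable i c) r = row_len c r + 1"
    by (rule row_len_eqI)
      (use True in \<open>auto simp: addable_iff_bead[OF c] mem_iff_row_len[OF c] bead_def\<close>)
  then show ?thesis using True by (simp add: bead_def)
next
  case False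
  then have "row_len (c \<union> addable i c) r = row_len c r"
    by (intro row_len_eqI) (auto simp: addable_iff_bead[OF c] mem_iff_row_len[OF c])
  then show ?thesis unfolding if_not_P[OF False] by (simp add: bead_def)
qed

text \<open>The involution of \<open>\<int>\<close> that exchanges \<open>x\<close> and \<open>x + 1\<close> whenever \<open>x \<equiv> i\<close> modulo 6. It is the
  action of the simple reflection \<open>s\<^sub>i\<close> as an affine permutation.\<close>

definition runner_swap :: "nat \<Rightarrow> int \<Rightarrow> int" where
  "runner_swap i x =
     (if x mod 6 = int i then x + 1 else if (x - 1) mod 6 = int i then x - 1 else x)"

lemma runner_swap_diff_6: "runner_swap i (x - 6) = runner_swap i x - 6"
proof -
  have "(x - 6) mod 6 = x mod 6" "(x - 6 - 1) mod 6 = (x - 1) mod 6" by presburger+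
  then show ?thesis unfolding runner_swap_def by simp
qed

lemma refl_act_partition: "is_partition c \<Longrightarrow> is_partition (refl_act i c)"
  by (auto simp: refl_act_def partition_remove partition_add)

lemma mem_image_move_down:
  fixes B :: "int set"
  shows "x \<in> (\<lambda>x. if Q (x - 1) \<and> x - 1 \<notin> B then x - 1 else x) ` B \<longleftrightarrow>
    x \<in> B \<and> \<not> (Q (x - 1) \<and> x - 1 \<notin> B) \<or> x + 1 \<in> B \<and> Q x \<and> x \<notin> B"
  by (auto simp: image_iff intro: bexI[of _ x] bexI[of _ "x + 1"])

lemma mem_image_move_up:
  fixes B :: "int set"
  shows "x \<in> (\<lambda>x. if Q x \<and> x + 1 \<notin> B then x + 1 else x) ` B \<longleftrightarrow>
    x \<in> B \<and> \<not> (Q x \<and> x + 1 \<notin> B) \<or> x - 1 \<in> B \<and> Q (x - 1) \<and> x \<notin> B"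
  by (auto simp: image_iff intro: bexI[of _ x] bexI[of _ "x - 1"])

text \<open>The reflection moves only those beads whose target is free, whereas \<open>runner_swap\<close> exchanges the
  two runners completely. The two agree if all moves go in the same direction: a pair of beads facing
  each other is exchanged without changing the set, and no bead moves against the others. For a
  6-core with a removable \<open>i\<close>-node, flushness forces the upward neighbour of every bead of
  residue \<open>i\<close> to be a bead; if there is no removable \<open>i\<close>-node, all moves go up by definition.\<close>

lemma mem_beads_refl_act_iff:
  assumes core: "c \<in> cores6"
  shows "x \<in> beads (refl_act i c) \<longleftrightarrow> runner_swap i x \<in> beads c"
proof (cases "removable i c = {}")
  case False
  note c = cores6_partition[OF core]
  from False obtain r k where "(r, k) \<in> removable i c" by auto
  then have y: "(bead c r - 1) mod 6 = int i" "bead c r - 1 \<notin> beads c"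
    unfolding removable_iff_bead[OF c] by blast+
  have up: "z + 1 \<in> beads c" if "z \<in> beads c" "z mod 6 = int i" for z
  proof -
    have "\<not> bead c r - 1 \<le> z" using core_beads_down[OF core that(1), of "bead c r - 1"] that(2) y by argo
    moreover have "bead c r mod 6 = (z + 1) mod 6"
      using mod_add_cong[of "bead c r - 1" 6 z 1 1] y(1) that(2) by simp
    ultimately show ?thesis using core_beads_down[OF core rangeI[of "bead c" r], of "z + 1"] by linarith
  qed
  have "beads (refl_act i c) =
      (\<lambda>x. if (x - 1) mod 6 = int i \<and> x - 1 \<notin> beads c then x - 1 else x) ` beads c"
    using False unfolding image_image by (intro image_cong) (simp_all add: refl_act_def bead_remove[OF c])
  then have *: "x \<in> beads (refl_act i c) \<longleftrightarrow>
      x \<in> beads c \<and> \<not> ((x - 1) mod 6 = int i \<and> x - 1 \<notin> beads c) \<or>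
      x + 1 \<in> beads c \<and> x mod 6 = int i \<and> x \<notin> beads c"
    by (simp only: mem_image_move_down[where Q = "\<lambda>x. x mod 6 = int i"])
  have "\<not> (x mod 6 = int i \<and> (x - 1) mod 6 = int i)" by presburger
  then show ?thesis using up[of x] up[of "x - 1"] unfolding * runner_swap_def by auto
next
  case True
  note c = cores6_partition[OF core]
  have down: "z \<in> beads c" if z: "z + 1 \<in> beads c" "z mod 6 = int i" for z
  proof (rule ccontr)
    assume "z \<notin> beads c"
    moreover obtain r where r: "z + 1 = bead c r" using z(1) by auto
    ultimately have *: "(bead c r - 1) mod 6 = int i \<and> bead c r - 1 \<notin> beads c"
      using z(2) by (simp flip: r)
    then have "row_len c (Suc r) < row_len c r"
      using row_len_antimono[OF c, of r "Suc r"] by (auto simp: bead_pred_in_beads_iff[OF c])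
    then have "(r, row_len c r - 1) \<in> removable i c"
      using * unfolding removable_iff_bead[OF c] by (simp add: bead_def)
    then show False using True by simp
  qed
  have "refl_act i c = c \<union> addable i c" using True by (simp add: refl_act_def)
  then have "beads (refl_act i c) =
      (\<lambda>x. if x mod 6 = int i \<and> x + 1 \<notin> beads c then x + 1 else x) ` beads c"
    unfolding image_image by (intro image_cong) (simp_all add: bead_add[OF c])
  then have *: "x \<in> beads (refl_act i c) \<longleftrightarrow>
      x \<in> beads c \<and> \<not> (x mod 6 = int i \<and> x + 1 \<notin> beads c) \<or>
      x - 1 \<in> beads c \<and> (x - 1) mod 6 = int i \<and> x \<notin> beads c"
    by (simp only: mem_image_move_up[where Q = "\<lambda>x. x mod 6 = int i"])
  have "\<not> (x mod 6 = int i \<and> (x - 1) mod 6 = int i)" by presburger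
  then show ?thesis using down[of x] down[of "x - 1"] unfolding * runner_swap_def by auto
qed

lemma refl_act_core:
  assumes core: "c \<in> cores6" shows "refl_act i c \<in> cores6"
  unfolding cores6_iff_beads[OF refl_act_partition[OF cores6_partition[OF core]]]
    Ball_def mem_beads_refl_act_iff[OF core] runner_swap_diff_6
  using core cores6_iff_beads[OF cores6_partition[OF core]] by blast


section \<open>Charges of the runners\<close>

text \<open>The bead set whose six runners are filled up to the levels \<open>b\<close>. A position is written as
  \<open>6 * q + j - 5\<close> with runner \<open>j < 6\<close> and level \<open>q\<close>; the offset is chosen such that the bead set
  \<open>{x. x \<le> 0}\<close> of the empty partition has all levels 0.\<close>

definition maya :: "int list \<Rightarrow> int set" where
  "maya b = {x. (x + 5) div 6 \<le> b ! nat ((x + 5) mod 6)}"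

lemma runner_coordinates:
  obtains q j where "x = 6 * q + int j - 5" "j < 6"
  by (rule that[of "(x + 5) div 6" "nat ((x + 5) mod 6)"]) simp_all

lemma runner_residue: "(6 * q + int j - 5) mod 6 = int (Suc j mod 6)"
proof -
  have "6 * q + int j - 5 = (1 + int j) + (q - 1) * 6" by simp
  then show ?thesis by (simp only: mod_mult_self1) (simp add: zmod_int)
qed

lemma mem_runner_if_residue:
  assumes "x mod 6 = int (Suc j mod 6)" obtains q where "x = 6 * q + int j - 5"
proof -
  have "x mod 6 = (1 + int j) mod 6" using assms by (simp add: zmod_int)
  then have "6 dvd x - (1 + int j)" by (simp add: mod_eq_dvd_iff)
  then obtain p where "x - (1 + int j) = 6 * p" by (rule dvdE)
  then show ?thesis by (intro that[of "p + 1"]) simp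
qed

lemma maya_runner_iff: "j < 6 \<Longrightarrow> 6 * q + int j - 5 \<in> maya b \<longleftrightarrow> q \<le> b ! j"
  by (simp add: maya_def)

lemma maya_inj:
  assumes "length b = 6" "length b' = 6" "maya b = maya b'" shows "b = b'"
proof (rule nth_equalityI)
  fix j assume "j < length b"
  then have "q \<le> b ! j \<longleftrightarrow> q \<le> b' ! j" for q
    using assms maya_runner_iff[of j q b] maya_runner_iff[of j q b'] by simp
  then show "b ! j = b' ! j" by (meson order_antisym order_refl)
qed (use assms in simp)

lemma length_beta: "length (beta c) = 6"
  by (simp add: beta_def)

lemma beta_nth:
  assumes "j < 6"
  shows "beta c ! j = int (num_nodes j c) - int (num_nodes (Suc j mod 6) c)"
proof -
  have "[1..<7] ! j = Suc j" using assms by (subst nth_upt) auto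
  then show ?thesis using assms by (simp add: beta_def)
qed

lemma num_nodes_eq_sum_rows:
  assumes c: "is_partition c" and N: "\<And>r. r \<ge> N \<Longrightarrow> row_len c r = 0"
  shows "num_nodes i c = (\<Sum>r<N. card {k. k < row_len c r \<and> (int k - int r) mod 6 = int i})"
proof -
  have "{b \<in> c. residue b = i} =
      (SIGMA r:{..<N}. {k. k < row_len c r \<and> (int k - int r) mod 6 = int i})"
  proof (rule Set.set_eqI)
    fix b :: "nat \<times> nat"
    obtain r k where b: "b = (r, k)" by force
    have "r < N" if "k < row_len c r" using that N[of r] by (cases "r < N") auto
    then show "b \<in> {b \<in> c. residue b = i} \<longleftrightarrow>
        b \<in> (SIGMA r:{..<N}. {k. k < row_len c r \<and> (int k - int r) mod 6 = int i})"
      unfolding b by (simp add: mem_iff_row_len[OF c] residue_eq_iff) blast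
  qed
  then show ?thesis by (simp add: num_nodes_def)
qed

text \<open>Going one box to the right raises the residue by 1, so in the difference between the numbers of
  \<open>j\<close>-nodes and of \<open>(j + 1)\<close>-nodes of a row only the two ends of the row survive.\<close>

lemma row_residue_telescope:
  fixes d :: int
  assumes "j < 6"
  shows "int (card {k. k < n \<and> (int k - d) mod 6 = int j}) -
      int (card {k. k < n \<and> (int k - d) mod 6 = int (Suc j mod 6)}) =
    of_bool ((int n - d) mod 6 = int (Suc j mod 6)) - of_bool ((- d) mod 6 = int (Suc j mod 6))"
proof (induction n)
  case (Suc n)
  have step: "int (card {k. k < Suc n \<and> P k}) = int (card {k. k < n \<and> P k}) + of_bool (P n)"
    for P
  proof -
    have "{k. k < Suc n \<and> P k} = (if P n then insert n {k. k < n \<and> P k} else {k. k < n \<and> P k})"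
      by (auto simp: less_Suc_eq)
    then show ?thesis by simp
  qed
  have "(int (Suc n) - d) mod 6 = int (Suc j mod 6) \<longleftrightarrow> (int n - d) mod 6 = int j"
  proof -
    have "(int (Suc n) - d) mod 6 = int (Suc j mod 6) \<longleftrightarrow>
        (int n - d + 1) mod 6 = (int j + 1) mod 6"
      by (simp add: zmod_int algebra_simps)
    also have "\<dots> \<longleftrightarrow> (int n - d) mod 6 = int j mod 6" by (simp add: mod_eq_dvd_iff)
    finally show ?thesis using assms by simp
  qed
  then show ?case using Suc.IH unfolding step by simp
qed simp

text \<open>Summed over the first \<open>6 * M\<close> rows, the right ends of the rows count the beads on runner \<open>j\<close>,
  and the left ends contribute what the same count gives for the empty partition, which is \<open>M\<close>.\<close>

lemma beta_nth_eq_card_beads: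
  assumes c: "is_partition c" and M: "\<And>r. r \<ge> 6 * M \<Longrightarrow> row_len c r = 0" and j: "j < 6"
  shows "beta c ! j = int (card {r. r < 6 * M \<and> bead c r mod 6 = int (Suc j mod 6)}) - int M"
proof -
  have count: "(\<Sum>r<n. of_bool (P r)) = int (card {r. r < n \<and> P r})" for n and P :: "nat \<Rightarrow> bool"
    by (simp add: sum.If_cases of_bool_def Collect_conj_eq lessThan_def)
  have "{r. r < 6 * M \<and> (- int r) mod 6 = int (Suc j mod 6)} = (\<lambda>m. 6 * m + (5 - j)) ` {..<M}"
  proof -
    have "j \<in> {0, 1, 2, 3, 4, 5}" using j by auto
    then have "(- int r) mod 6 = int (Suc j mod 6) \<longleftrightarrow> r mod 6 = 5 - j" for r
      by (elim insertE emptyE; simp; presburger)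
    moreover have "{r. r < 6 * M \<and> r mod 6 = 5 - j} = (\<lambda>m. 6 * m + (5 - j)) ` {..<M}"
    proof (intro equalityI subsetI)
      fix r assume r: "r \<in> {r. r < 6 * M \<and> r mod 6 = 5 - j}"
      then have "r = 6 * (r div 6) + (5 - j)" using mult_div_mod_eq[of 6 r] by simp
      moreover have "r div 6 \<in> {..<M}" using r by auto
      ultimately show "r \<in> (\<lambda>m. 6 * m + (5 - j)) ` {..<M}" by (rule image_eqI)
    qed auto
    ultimately show ?thesis by simp
  qed
  then have vac: "card {r. r < 6 * M \<and> (- int r) mod 6 = int (Suc j mod 6)} = M"
    by (simp add: card_image inj_on_def)
  have rows: "num_nodes i c =
      (\<Sum>r<6 * M. card {k. k < row_len c r \<and> (int k - int r) mod 6 = int i})" for i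
    by (rule num_nodes_eq_sum_rows[OF c]) (rule M)
  have "beta c ! j = (\<Sum>r<6 * M.
      of_bool (bead c r mod 6 = int (Suc j mod 6)) - of_bool ((- int r) mod 6 = int (Suc j mod 6)))"
    unfolding beta_nth[OF j] rows of_nat_sum sum_subtractf[symmetric]
      row_residue_telescope[OF j] bead_def ..
  then show ?thesis unfolding sum_subtractf count vac .
qed

text \<open>Since a runner of a 6-core is flush, its level is determined by the number of its beads above
  \<open>- 6 * M\<close>, where \<open>M\<close> is so large that all positions up to \<open>- 6 * M\<close> are occupied; and \<open>beta\<close> counts
  these beads, up to the constant \<open>M\<close>.\<close>

lemma beads_eq_maya_beta:
  assumes core: "c \<in> cores6" shows "beads c = maya (beta c)"
proof -
  note c = cores6_partition[OF core]
  obtain M where "\<And>r. r \<ge> M \<Longrightarrow> row_len c r = 0" using eventually_row_len_0[OF c] by blast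
  then have M: "\<And>r. r \<ge> 6 * M \<Longrightarrow> row_len c r = 0" by simp
  have low: "x \<in> beads c" if "x \<le> - 6 * int M" for x
  proof -
    have "bead c (nat (- x)) = x" using that M[of "nat (- x)"] by (simp add: bead_def)
    then show ?thesis using rangeI[of "bead c" "nat (- x)"] by (simp only:)
  qed
  have high: "r < 6 * M \<longleftrightarrow> bead c r > - 6 * int M" for r
    using M[of r] by (cases "r < 6 * M") (auto simp: bead_def)
  have "6 * q + int j - 5 \<in> beads c \<longleftrightarrow> q \<le> beta c ! j" if j: "j < 6" for q j
  proof -
    \<comment> \<open>the positions of runner \<open>j\<close> above \<open>- 6 * M\<close>, in increasing order; the beads there are those
      of the first \<open>6 * M\<close> rows\<close>
    let ?pos = "\<lambda>n. 6 * (int n - int M + 1) + int j - 5"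
    let ?S = "{n. ?pos n \<in> beads c}" and ?R = "{r. r < 6 * M \<and> bead c r mod 6 = int (Suc j mod 6)}"
    have image: "?pos ` ?S = bead c ` ?R"
    proof (intro equalityI subsetI)
      fix x assume "x \<in> ?pos ` ?S"
      then obtain n where x: "x = ?pos n" "x \<in> beads c" by blast
      from x(2) obtain r where r: "x = bead c r" by blast
      have "x mod 6 = int (Suc j mod 6)" unfolding x(1) by (rule runner_residue)
      moreover have "x > - 6 * int M" using x(1) by simp
      ultimately show "x \<in> bead c ` ?R" using high r by blast
    next
      fix x assume "x \<in> bead c ` ?R"
      then obtain r where r: "x = bead c r" "r < 6 * M" "x mod 6 = int (Suc j mod 6)" by blast
      obtain q where q: "x = 6 * q + int j - 5" by (rule mem_runner_if_residue[OF r(3)])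
      have "x > - 6 * int M" using high r by simp
      then have "x = ?pos (nat (q + int M - 1))" using q j by simp
      moreover from this have "nat (q + int M - 1) \<in> ?S"
        using rangeI[of "bead c" r] unfolding mem_Collect_eq r(1) by (simp only:)
      ultimately show "x \<in> ?pos ` ?S" by (rule image_eqI)
    qed
    have pos: "inj_on ?pos ?S" by (simp add: inj_on_def)
    have "inj_on (bead c) ?R" using inj_bead[OF c] by (rule inj_on_subset) simp
    then have card: "card ?S = card ?R"
      unfolding card_image[OF pos, symmetric] image by (rule card_image)
    have "finite (?pos ` ?S)" unfolding image by simp
    then have fin: "finite ?S" using pos by (rule finite_imageD)
    have down: "b \<in> ?S" if "a \<in> ?S" "b \<le> a" for a b
    proof -
      have "?pos b \<le> ?pos a" using that(2) by simp
      moreover have "?pos a mod 6 = ?pos b mod 6" unfolding runner_residue ..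
      ultimately show ?thesis using core_beads_down[OF core, of "?pos a" "?pos b"] that(1) by blast
    qed
    have S: "?S = {..<card ?S}" using fin down by (rule finite_down_set_eq_lessThan_card)
    have b: "beta c ! j = int (card ?S) - int M"
      using beta_nth_eq_card_beads[OF c M j] card by simp
    show ?thesis
    proof (cases "q \<le> - int M")
      case True
      then have "6 * q + int j - 5 \<in> beads c" by (intro low) (use j in simp)
      then show ?thesis using True b by simp
    next
      case False
      then have "6 * q + int j - 5 = ?pos (nat (q + int M - 1))" by simp
      then have "6 * q + int j - 5 \<in> beads c \<longleftrightarrow> nat (q + int M - 1) \<in> ?S"
        unfolding mem_Collect_eq by (rule arg_cong)
      also have "\<dots> \<longleftrightarrow> nat (q + int M - 1) < card ?S" by (subst S) (rule lessThan_iff)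
      finally have "6 * q + int j - 5 \<in> beads c \<longleftrightarrow> nat (q + int M - 1) < card ?S" .
      then show ?thesis using False b by auto
    qed
  qed
  then have runner: "6 * q + int j - 5 \<in> beads c \<longleftrightarrow> 6 * q + int j - 5 \<in> maya (beta c)"
    if "j < 6" for q j
    using that by (simp only: maya_runner_iff)
  show ?thesis
  proof (rule Set.set_eqI)
    fix x
    obtain q j where "x = 6 * q + int j - 5" "j < 6" by (rule runner_coordinates)
    then show "x \<in> beads c \<longleftrightarrow> x \<in> maya (beta c)" using runner by (simp only:)
  qed
qed

lemma core_eq_if_beta_eq: "c \<in> cores6 \<Longrightarrow> d \<in> cores6 \<Longrightarrow> beta c = beta d \<Longrightarrow> c = d"
  by (rule partition_eq_if_beads_eq) (simp_all only: cores6_partition beads_eq_maya_beta)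


section \<open>The action on charge vectors\<close>

text \<open>For \<open>i = 0\<close> the two runners meet across a period: the position above \<open>6 * q\<close>, which has level
  \<open>q\<close> on the last runner, has level \<open>q + 1\<close> on the first one. This is the source of the shift by 1.\<close>

definition refl_vec :: "nat \<Rightarrow> int list \<Rightarrow> int list" where
  "refl_vec i b =
     (if i = 0 then b[0 := b ! 5 + 1, 5 := b ! 0 - 1] else b[i - 1 := b ! i, i := b ! (i - 1)])"

lemma length_refl_vec [simp]: "length (refl_vec i b) = length b"
  by (simp add: refl_vec_def)

lemma length_foldr_refl_vec [simp]: "length (foldr refl_vec u b) = length b"
  by (induction u) simp_all

lemma mem_maya_refl_vec_iff:
  assumes "length b = 6" "i < 6"
  shows "x \<in> maya (refl_vec i b) \<longleftrightarrow> runner_swap i x \<in> maya b"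
proof -
  obtain q j where x: "x = 6 * q + int j - 5" and j: "j < 6" by (rule runner_coordinates)
  have "x mod 6 = int (Suc j mod 6)" unfolding x by (rule runner_residue)
  moreover have "(x - 1) mod 6 = int j"
  proof -
    have "x - 1 = int j + (q - 1) * 6" using x by simp
    then show ?thesis using j by (simp only: mod_mult_self1) simp
  qed
  ultimately have "x mod 6 = int i \<longleftrightarrow> i = Suc j mod 6" "(x - 1) mod 6 = int i \<longleftrightarrow> i = j"
    by auto
  then have swap: "runner_swap i x =
      (if i = Suc j mod 6 then x + 1 else if i = j then x - 1 else x)"
    by (simp add: runner_swap_def)
  consider "i = 0" "j = 5" | "i = 0" "j = 0" | "i = Suc j" | "i = j" "j > 0"
    | "i \<noteq> Suc j mod 6" "i \<noteq> j"
    using j by (cases "j = 5"; cases "j = 0") auto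
  then show ?thesis
  proof cases
    case 1
    then have "runner_swap i x = 6 * (q + 1) + int 0 - 5" using swap x by simp
    then show ?thesis unfolding x using 1 assms
      by (simp only: maya_runner_iff) (auto simp: refl_vec_def maya_runner_iff[of 0])
  next
    case 2
    then have "runner_swap i x = 6 * (q - 1) + int 5 - 5" using swap x by simp
    then show ?thesis unfolding x using 2 assms
      by (simp only: maya_runner_iff) (auto simp: refl_vec_def)
  next
    case 3
    then have "runner_swap i x = 6 * q + int (Suc j) - 5" using swap x assms by simp
    then show ?thesis unfolding x using 3 j assms
      by (simp only: maya_runner_iff) (auto simp: refl_vec_def)
  next
    case 4
    then have "runner_swap i x = 6 * q + int (j - 1) - 5" using swap x j by (auto simp: mod_Suc)
    then show ?thesis unfolding x using 4 j assms
      by (simp only: maya_runner_iff) (auto simp: refl_vec_def)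
  next
    case 5
    then have "runner_swap i x = 6 * q + int j - 5" using swap x by simp
    moreover have "refl_vec i b ! j = b ! j"
      using 5 assms j by (cases "j = 5") (auto simp: refl_vec_def nth_list_update)
    ultimately show ?thesis unfolding x using j by (simp only: maya_runner_iff)
  qed
qed

lemma beta_refl_act:
  assumes "c \<in> cores6" "i < 6" shows "beta (refl_act i c) = refl_vec i (beta c)"
proof (rule maya_inj)
  show "maya (beta (refl_act i c)) = maya (refl_vec i (beta c))"
    unfolding beads_eq_maya_beta[OF refl_act_core[OF assms(1)], symmetric]
    by (rule Set.set_eqI)
      (simp only: mem_beads_refl_act_iff[OF assms(1)] beads_eq_maya_beta[OF assms(1)]
        mem_maya_refl_vec_iff[OF length_beta assms(2)])
qed (simp_all add: length_beta)

lemma word_act_core: "c \<in> cores6 \<Longrightarrow> word_act u c \<in> cores6"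
  by (induction u) (simp_all add: word_act_def refl_act_core)

lemma beta_word_act:
  assumes "c \<in> cores6" "u \<in> words" shows "beta (word_act u c) = foldr refl_vec u (beta c)"
  using assms(2)
proof (induction u)
  case (Cons i u)
  then show ?case using beta_refl_act[OF word_act_core[OF assms(1), of u], of i]
    by (simp add: words_def word_act_def)
qed (simp add: word_act_def)

lemma length_6_cases:
  assumes "length b = 6" obtains x0 x1 x2 x3 x4 x5 where "b = [x0, x1, x2, x3, x4, x5]"
proof -
  have "length b = Suc (Suc (Suc (Suc (Suc (Suc 0)))))" using assms by simp
  then show ?thesis using that by (auto simp only: length_Suc_conv length_0_conv)
qed

lemma refl_vec_list:
  "refl_vec 0 [x0, x1, x2, x3, x4, x5] = [x5 + 1, x1, x2, x3, x4, x0 - 1]"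
  "refl_vec (Suc 0) [x0, x1, x2, x3, x4, x5] = [x1, x0, x2, x3, x4, x5]"
  "refl_vec 2 [x0, x1, x2, x3, x4, x5] = [x0, x2, x1, x3, x4, x5]"
  "refl_vec 3 [x0, x1, x2, x3, x4, x5] = [x0, x1, x3, x2, x4, x5]"
  "refl_vec 4 [x0, x1, x2, x3, x4, x5] = [x0, x1, x2, x4, x3, x5]"
  "refl_vec 5 [x0, x1, x2, x3, x4, x5] = [x0, x1, x2, x3, x5, x4]"
  by (simp_all add: refl_vec_def eval_nat_numeral)

lemma refl_vec_Coxeter:
  assumes "length b = 6" "i < 6" "j < 6"
  shows "foldr refl_vec (concat (replicate (cox_m i j) [i, j])) b = b"
proof -
  obtain x0 x1 x2 x3 x4 x5 where "b = [x0, x1, x2, x3, x4, x5]"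
    by (rule length_6_cases[OF assms(1)])
  moreover have "i \<in> {0, 1, 2, 3, 4, 5}" "j \<in> {0, 1, 2, 3, 4, 5}" using assms by auto
  moreover have "replicate 2 w = [w, w]" "replicate 3 w = [w, w, w]" for w :: "nat list"
    by (simp_all add: numeral_eq_Suc)
  ultimately show ?thesis
    by (elim insertE emptyE) (simp_all add: cox_m_def refl_vec_list)
qed

lemma foldr_refl_vec_cox_step:
  "cox_step u v \<Longrightarrow> length b = 6 \<Longrightarrow> foldr refl_vec u b = foldr refl_vec v b"
  by (induction rule: cox_step.induct) (simp add: refl_vec_Coxeter)

lemma foldr_refl_vec_equiv:
  "equivclp cox_step u v \<Longrightarrow> length b = 6 \<Longrightarrow> foldr refl_vec u b = foldr refl_vec v b"
  by (induction rule: equivclp_induct) (auto dest: foldr_refl_vec_cox_step)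

text \<open>The well-definedness of the action: congruent words act in the same way on vectors, hence on
  6-cores, so the image over which \<open>core_act\<close> takes \<open>the_elem\<close> is a singleton.\<close>

lemma core_act_word_elt:
  assumes c: "c \<in> cores6" and u: "u \<in> words"
  shows "core_act (word_elt u) c = word_act u c"
proof -
  have "word_act v c = word_act u c" if "v \<in> word_elt u" for v
  proof (rule core_eq_if_beta_eq)
    have v: "v \<in> words" "equivclp cox_step u v"
      using that by (auto simp: word_elt_def cox_rel_def)
    show "beta (word_act v c) = beta (word_act u c)"
      using foldr_refl_vec_equiv[OF v(2) length_beta] by (simp add: beta_word_act c u v(1))
  qed (simp_all add: word_act_core c)
  then have "(\<lambda>v. word_act v c) ` word_elt u = (\<lambda>v. word_act u c) ` word_elt u"
    by (rule image_cong[OF refl])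
  also have "\<dots> = {word_act u c}"
    by (rule image_constant[of u]) (use u in \<open>simp add: word_elt_def cox_rel_def\<close>)
  finally show ?thesis using c by (simp add: core_act_def)
qed


section \<open>The twisted lattice and its affine Weyl group\<close>

definition g_vec :: "int \<Rightarrow> int \<Rightarrow> int list" where
  "g_vec a b = [a, b, a - b, b - a, - b, - a]"

definition D43_words :: "nat list set" where
  "D43_words = {[0, 1, 5, 0], [2, 4], [1, 3, 5]}"

lemma W_D43_eq: "W_D43 = generate aff_S6 (word_elt ` D43_words)"
  by (simp add: W_D43_def D43_words_def)

lemma D43_words_words: "u \<in> D43_words \<Longrightarrow> u \<in> words"
  by (auto simp: D43_words_def words_def)

text \<open>The reversed words represent the inverses of the generators. They act in the same way, because
  each generator is, up to conjugation by \<open>s\<^sub>0\<close>, a product of commuting reflections and hence an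
  involution.\<close>

lemma refl_vec_g_vec:
  "foldr refl_vec [0, 1, 5, 0] (g_vec a b) = g_vec (1 - b) (1 - a)"
  "foldr refl_vec [0, 5, 1, 0] (g_vec a b) = g_vec (1 - b) (1 - a)"
  "foldr refl_vec [2, 4] (g_vec a b) = g_vec a (a - b)"
  "foldr refl_vec [4, 2] (g_vec a b) = g_vec a (a - b)"
  "foldr refl_vec [1, 3, 5] (g_vec a b) = g_vec b a"
  "foldr refl_vec [5, 3, 1] (g_vec a b) = g_vec b a"
  by (simp_all add: g_vec_def refl_vec_list)

lemma inv_word_elt:
  assumes "u \<in> words" shows "inv\<^bsub>aff_S6\<^esub> word_elt u = word_elt (rev u)"
proof (rule group.inv_equality[OF group_aff_S6])
  have r: "rev u \<in> words" using assms by (auto simp: words_def)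
  show "word_elt (rev u) \<otimes>\<^bsub>aff_S6\<^esub> word_elt u = \<one>\<^bsub>aff_S6\<^esub>"
    by (simp add: mult_word_elt r assms word_elt_rev one_aff_S6)
  show "word_elt u \<in> carrier aff_S6" "word_elt (rev u) \<in> carrier aff_S6"
    using assms r by (auto simp: carrier_aff_S6)
qed

lemma W_D43_preserves_g_vec:
  assumes "w \<in> W_D43"
  shows "\<exists>u\<in>words. w = word_elt u \<and> (\<forall>a b. \<exists>a' b'. foldr refl_vec u (g_vec a b) = g_vec a' b')"
  using assms unfolding W_D43_eq
proof (induction rule: generate.induct)
  case one
  have "[] \<in> words" by (simp add: words_def)
  then show ?case by (intro bexI[of _ "[]"]) (auto simp: one_aff_S6)
next
  case (incl h)
  then obtain u where u: "u \<in> D43_words" "h = word_elt u" by auto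
  then have "\<exists>a' b'. foldr refl_vec u (g_vec a b) = g_vec a' b'" for a b
    unfolding D43_words_def by (elim conjE insertE emptyE) (simp only: refl_vec_g_vec, blast)+
  then show ?case using u D43_words_words by blast
next
  case (inv h)
  then obtain u where u: "u \<in> D43_words" "h = word_elt u" by auto
  from u(1) have "rev u \<in> {[0, 5, 1, 0], [4, 2], [5, 3, 1]}" by (auto simp: D43_words_def)
  then have "\<exists>a' b'. foldr refl_vec (rev u) (g_vec a b) = g_vec a' b'" for a b
    by (elim insertE emptyE) (simp only: refl_vec_g_vec, blast)+
  moreover have "rev u \<in> words" using D43_words_words[OF u(1)] by (auto simp: words_def)
  ultimately show ?case using u inv_word_elt[OF D43_words_words[OF u(1)]] by blast
next
  case (eng h1 h2)
  then obtain u v where "u \<in> words" "h1 = word_elt u" "v \<in> words" "h2 = word_elt v"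
    "\<forall>a b. \<exists>a' b'. foldr refl_vec u (g_vec a b) = g_vec a' b'"
    "\<forall>a b. \<exists>a' b'. foldr refl_vec v (g_vec a b) = g_vec a' b'" by blast
  then show ?case
    by (intro bexI[of _ "u @ v"] conjI) (simp_all add: mult_word_elt append_in_words, metis)
qed

text \<open>The maps \<open>r\<^sub>1\<close> and \<open>r\<^sub>2\<close> alternate to give \<open>(a, b) \<mapsto> (- b, - a)\<close>. With \<open>r\<^sub>0\<close> this yields the
  translations by \<open>(1, 1)\<close> and \<open>(-1, -1)\<close>, and conjugation by \<open>r\<^sub>1\<close> makes them translations by
  \<open>(1, 0)\<close> and \<open>(-1, 0)\<close>. The other coordinate follows by the swap \<open>r\<^sub>2\<close>.\<close>

lemma lattice_transitive:
  fixes P :: "int \<Rightarrow> int \<Rightarrow> bool"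
  assumes zero: "P 0 0" and r0: "\<And>a b. P a b \<Longrightarrow> P (1 - b) (1 - a)"
    and r1: "\<And>a b. P a b \<Longrightarrow> P a (a - b)" and r2: "\<And>a b. P a b \<Longrightarrow> P b a"
  shows "P a b"
proof -
  have neg: "P (- b) (- a)" if "P a b" for a b
    using r1[OF r2[OF r1[OF r2[OF r1[OF that]]]]] by simp
  have up: "P (a + 1) b" if "P a b" for a b
    using r1[OF r0[OF neg[OF r1[OF that]]]] by (simp add: algebra_simps)
  have down: "P (a - 1) b" if "P a b" for a b
    using r1[OF neg[OF r0[OF r1[OF that]]]] by (simp add: algebra_simps)
  have shift: "P a b" if "P 0 b" for a b
    using that up down by (induction a rule: int_induct[of _ 0]) auto
  show ?thesis using shift[OF r2[OF shift[OF zero]]] .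
qed

lemma empty_core: "{} \<in> cores6"
  by (simp add: cores6_def is_partition_def)

lemma beta_empty: "beta {} = g_vec 0 0"
proof -
  have "[1..<7] = [1, 2, 3, 4, 5, 6::nat]" by (simp add: upt_rec)
  then show ?thesis by (simp add: beta_def num_nodes_def g_vec_def)
qed

lemma W_D43_reaches_g_vec:
  "\<exists>u\<in>words. word_elt u \<in> W_D43 \<and> foldr refl_vec u (g_vec 0 0) = g_vec a b"
proof (rule lattice_transitive)
  have "[] \<in> words" by (simp add: words_def)
  moreover have "word_elt [] \<in> W_D43"
    unfolding W_D43_eq one_aff_S6[symmetric] by (rule generate.one)
  ultimately show "\<exists>u\<in>words. word_elt u \<in> W_D43 \<and> foldr refl_vec u (g_vec 0 0) = g_vec 0 0"
    by force
next
  have step: "\<exists>u\<in>words. word_elt u \<in> W_D43 \<and> foldr refl_vec u (g_vec 0 0) = foldr refl_vec g (g_vec a b)"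
    if u: "\<exists>u\<in>words. word_elt u \<in> W_D43 \<and> foldr refl_vec u (g_vec 0 0) = g_vec a b"
      and g: "g \<in> D43_words" for g a b
  proof -
    from u obtain u where u: "u \<in> words" "word_elt u \<in> W_D43"
      "foldr refl_vec u (g_vec 0 0) = g_vec a b" by blast
    have "word_elt g \<otimes>\<^bsub>aff_S6\<^esub> word_elt u \<in> W_D43"
      unfolding W_D43_eq
      by (rule generate.eng[OF generate.incl[OF imageI[OF g]] u(2)[unfolded W_D43_eq]])
    then have "word_elt (g @ u) \<in> W_D43" by (simp add: mult_word_elt u(1) D43_words_words g)
    then show ?thesis using u append_in_words[OF D43_words_words[OF g] u(1)]
      by (intro bexI[of _ "g @ u"]) simp_all
  qed
  fix a b assume *: "\<exists>u\<in>words. word_elt u \<in> W_D43 \<and> foldr refl_vec u (g_vec 0 0) = g_vec a b"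
  show "\<exists>u\<in>words. word_elt u \<in> W_D43 \<and> foldr refl_vec u (g_vec 0 0) = g_vec (1 - b) (1 - a)"
    using step[OF *, of "[0, 1, 5, 0]"] unfolding refl_vec_g_vec by (simp add: D43_words_def)
  show "\<exists>u\<in>words. word_elt u \<in> W_D43 \<and> foldr refl_vec u (g_vec 0 0) = g_vec a (a - b)"
    using step[OF *, of "[2, 4]"] unfolding refl_vec_g_vec by (simp add: D43_words_def)
  show "\<exists>u\<in>words. word_elt u \<in> W_D43 \<and> foldr refl_vec u (g_vec 0 0) = g_vec b a"
    using step[OF *, of "[1, 3, 5]"] unfolding refl_vec_g_vec by (simp add: D43_words_def)
qed

lemma cores6_g_iff: "c \<in> cores6_g \<longleftrightarrow> c \<in> cores6 \<and> (\<exists>a b. beta c = g_vec a b)"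
  by (simp add: cores6_g_def g_vec_def)

theorem lemma5p13:
  shows "orbit (aff_S6\<lparr>carrier := W_D43\<rparr>) core_act {} = cores6_g"
proof (intro equalityI subsetI)
  fix c assume "c \<in> orbit (aff_S6\<lparr>carrier := W_D43\<rparr>) core_act {}"
  then obtain w where w: "w \<in> W_D43" "c = core_act w {}" by (auto simp: orbit_def)
  obtain u a b where u: "u \<in> words" "w = word_elt u" "foldr refl_vec u (g_vec 0 0) = g_vec a b"
    using W_D43_preserves_g_vec[OF w(1)] by blast
  have "c = word_act u {}" using w(2) u core_act_word_elt[OF empty_core] by simp
  then show "c \<in> cores6_g"
    using u word_act_core[OF empty_core] beta_word_act[OF empty_core u(1)]
    by (auto simp: cores6_g_iff beta_empty)
next
  fix c assume "c \<in> cores6_g"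
  then obtain a b where c: "c \<in> cores6" "beta c = g_vec a b" by (auto simp: cores6_g_iff)
  obtain u where u: "u \<in> words" "word_elt u \<in> W_D43" "foldr refl_vec u (g_vec 0 0) = g_vec a b"
    using W_D43_reaches_g_vec by blast
  have "word_act u {} = c"
    using c u by (intro core_eq_if_beta_eq word_act_core empty_core)
      (simp_all add: beta_word_act empty_core beta_empty)
  then have "c = core_act (word_elt u) {}" using core_act_word_elt[OF empty_core u(1)] by simp
  then show "c \<in> orbit (aff_S6\<lparr>carrier := W_D43\<rparr>) core_act {}"
    using u(2) by (auto simp: orbit_def)
qed

end
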